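(* (1) $S_{2,2,1}\not\le S_{3,1,1}$. (2) $P_6\not\le S_{3,1,1}$. (3) $S_{3,1,1}\not\le P_6$. (4) $S_{2,2,1}\not\le P_6$.
   Context: All graphs are finite and simple, considered up to isomorphism. An edge-colored graph is a pair $(G,c)$ with $c\colon E(G)\to\mathbb{N}$ an arbitrary map (not necessarily proper); it is colored in $t$ or more colors if $|c(E(G))|\ge t$. A subgraph (not necessarily induced) is rainbow if its edges receive pairwise distinct colors. $(G,c)$ is rainbow $H$-free if $G$ contains no rainbow subgraph isomorphic to $H$. For graphs $H_1,H_2$, write $H_1\le H_2$ if there is a positive integer $t$ such that every rainbow $H_1$-free edge-colored complete graph colored in $t$ or more colors is rainbow $H_2$-free. $P_k$ is the path on $k$ vertices. For positive integers $a,b,c$, $S_{a,b,c}$ is the tree consisting of one vertex (the branch vertex) joined by three internally disjoint paths of lengths $a$, $b$, $c$; it has $a+b+c+1$ vertices. *)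

theory Defs
  imports Main
begin

text \<open>A graph is a pair of a vertex set and a set of edges, the edges being two-element
  sets of vertices.\<close>

type_synonym 'a graph = "'a set \<times> 'a set set"

abbreviation verts :: "'a graph \<Rightarrow> 'a set" where "verts \<equiv> fst"
abbreviation edges :: "'a graph \<Rightarrow> 'a set set" where "edges \<equiv> snd"

definition simple_graph :: "'a graph \<Rightarrow> bool" where
  "simple_graph G \<longleftrightarrow> finite (verts G) \<and> edges G \<subseteq> {e. e \<subseteq> verts G \<and> card e = 2}"

definition complete_graph :: "'a graph \<Rightarrow> bool" where
  "complete_graph G \<longleftrightarrow> finite (verts G) \<and> edges G = {e. e \<subseteq> verts G \<and> card e = 2}"

definition subgraph :: "'a graph \<Rightarrow> 'a graph \<Rightarrow> bool" where
  "subgraph F G \<longleftrightarrow> simple_graph F \<and> verts F \<subseteq> verts G \<and> edges F \<subseteq> edges G"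

definition graph_iso :: "'a graph \<Rightarrow> 'b graph \<Rightarrow> bool" where
  "graph_iso G H \<longleftrightarrow>
     (\<exists>f. bij_betw f (verts G) (verts H) \<and> edges H = (\<lambda>e. f ` e) ` edges G)"

text \<open>An edge coloring of \<open>G\<close> is a function on all sets of vertices, of which only the
  values on \<open>edges G\<close> are ever used.\<close>

type_synonym 'a coloring = "'a set \<Rightarrow> nat"

definition rainbow :: "'a coloring \<Rightarrow> 'a graph \<Rightarrow> bool" where
  "rainbow c F \<longleftrightarrow> inj_on c (edges F)"

definition rainbow_free :: "'b graph \<Rightarrow> 'a graph \<Rightarrow> 'a coloring \<Rightarrow> bool" where
  "rainbow_free H G c \<longleftrightarrow> \<not> (\<exists>F. subgraph F G \<and> rainbow c F \<and> graph_iso F H)"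

text \<open>Finite graphs being considered up to isomorphism, the complete graphs below may be taken
  to have natural numbers as vertices.\<close>

definition rainbow_le :: "'a graph \<Rightarrow> 'b graph \<Rightarrow> bool"  (infix "\<preceq>" 50) where
  "H1 \<preceq> H2 \<longleftrightarrow>
     (\<exists>t::nat. t > 0 \<and>
       (\<forall>(G :: nat graph) c.
          complete_graph G \<and> card (c ` edges G) \<ge> t \<and> rainbow_free H1 G c
          \<longrightarrow> rainbow_free H2 G c))"

definition path_graph :: "nat \<Rightarrow> nat graph" where
  "path_graph k = ({..<k}, {{i, Suc i} | i. Suc i < k})"

text \<open>The vertex at distance \<open>j\<close> from the branch vertex on leg \<open>i\<close>;
  the three legs share the branch vertex \<open>(0, 0)\<close>.\<close>

definition leg :: "nat \<Rightarrow> nat \<Rightarrow> nat \<times> nat" where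
  "leg i j = (if j = 0 then (0, 0) else (i, j))"

definition spider :: "nat \<Rightarrow> nat \<Rightarrow> nat \<Rightarrow> (nat \<times> nat) graph" where
  "spider a b c =
     ({leg i j | i j. i < 3 \<and> j \<le> [a, b, c] ! i},
      {{leg i j, leg i (Suc j)} | i j. i < 3 \<and> j < [a, b, c] ! i})"

end

theory Submission
  imports Defs
begin

text \<open>Three colorings of the complete graph on the natural numbers suffice, each with one
  background color 0 and unboundedly many colors on a star or a perfect matching.

  \<^item> The star at 0 is rainbow, except that the triangle 012 is monochromatic. A rainbow graph has at
    most two edges avoiding 0, so 0 has degree at least 3 in a rainbow tree with five edges. This
    excludes the path. In the spider with legs 2, 2, 1 both outer edges would have to avoid 0, but
    the only such edge that is not in the background is 12, and then the inner edge next to it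
    lies in the triangle.
  \<^item> A perfect matching is rainbow, and the remaining four edges joining the first two matching edges
    share one further color. At least three edges of a rainbow graph with five edges lie in the
    matching, and the spider with legs 3, 1, 1 has no three disjoint edges.
  \<^item> The vertex 0 is joined by a rainbow star to all vertices except 1, 2, 3, and the triangle 123
    has two colors. Every path on four vertices has a background edge, which in a rainbow spider
    with legs 2, 2, 1 forces a background edge on each of the two long legs.\<close>

section \<open>Rainbow copies as injective vertex maps\<close>

text \<open>In a complete graph every injection of vertices maps edges to edges, so no host graph
  appears and one coloring of all pairs serves every finite host.\<close>

definition rainbow_copy :: "'a coloring \<Rightarrow> 'b graph \<Rightarrow> ('b \<Rightarrow> 'a) \<Rightarrow> bool" where
  "rainbow_copy c H g \<longleftrightarrow> inj_on g (verts H) \<and> inj_on (\<lambda>e. c (g ` e)) (edges H)"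

lemma rainbow_copy_of_iso:
  assumes F: "simple_graph F" "rainbow c F" and iso: "graph_iso F H"
  shows "\<exists>g. rainbow_copy c H g"
proof -
  obtain f where f: "bij_betw f (verts F) (verts H)" and H: "edges H = (\<lambda>e. f ` e) ` edges F"
    using iso by (auto simp: graph_iso_def)
  define g where "g = inv_into (verts F) f"
  have gf: "g ` f ` e = e" if "e \<in> edges F" for e
  proof -
    have "e \<subseteq> verts F"
      using that F by (auto simp: simple_graph_def)
    then show ?thesis
      using f by (simp add: g_def bij_betw_def inv_into_image_cancel)
  qed
  have "inj_on g (verts H)"
    using f by (metis bij_betw_imp_inj_on bij_betw_inv_into g_def)
  moreover have "inj_on (\<lambda>e. c (g ` e)) (edges H)"
    using F(2) gf by (auto simp: H rainbow_def inj_on_def)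
  ultimately show ?thesis
    by (auto simp: rainbow_copy_def)
qed

lemma rainbow_copy_not_free:
  assumes H: "simple_graph H" and G: "complete_graph G"
    and g: "rainbow_copy c H g" "g ` verts H \<subseteq> verts G"
  shows "\<not> rainbow_free H G c"
proof -
  define F where "F = (g ` verts H, (\<lambda>e. g ` e) ` edges H)"
  have inj: "inj_on g (verts H)"
    using g by (simp add: rainbow_copy_def)
  have F: "simple_graph F"
    unfolding simple_graph_def
  proof safe
    show "finite (verts F)"
      using H by (simp add: F_def simple_graph_def)
    fix e assume "e \<in> edges F"
    then obtain d where d: "d \<in> edges H" "e = g ` d"
      by (auto simp: F_def)
    then have dH: "d \<subseteq> verts H" "card d = 2"
      using H by (auto simp: simple_graph_def)
    then show "card e = 2"
      using d(2) inj by (metis card_image inj_on_subset)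
    show "x \<in> verts F" if "x \<in> e" for x
      using that d dH by (auto simp: F_def)
  qed
  moreover have "verts F \<subseteq> verts G"
    using g(2) by (simp add: F_def)
  ultimately have "subgraph F G"
    using G by (auto simp: subgraph_def simple_graph_def complete_graph_def)
  moreover have "rainbow c F"
    using g(1) by (auto simp: F_def rainbow_def rainbow_copy_def inj_on_def)
  moreover have "graph_iso F H"
    unfolding graph_iso_def
  proof (intro exI conjI)
    show "bij_betw (inv_into (verts H) g) (verts F) (verts H)"
      using inj by (simp add: F_def bij_betw_inv_into inj_on_imp_bij_betw)
    have "inv_into (verts H) g ` g ` e = e" if "e \<in> edges H" for e
      using that H inj by (auto simp: simple_graph_def subset_iff inv_into_image_cancel)
    then show "edges H = (\<lambda>e. inv_into (verts H) g ` e) ` edges F"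
      by (force simp: F_def image_image)
  qed
  ultimately show ?thesis
    unfolding rainbow_free_def by blast
qed

text \<open>A single coloring of the infinite complete graph on the natural numbers yields colorings
  of finite complete graphs with arbitrarily many colors.\<close>

lemma not_rainbow_leI:
  fixes c :: "nat coloring"
  assumes inf: "infinite (c ` {e. card e = 2})"
    and free: "\<nexists>g. rainbow_copy c H1 g"
    and H2: "simple_graph H2" and copy: "\<exists>g. rainbow_copy c H2 g"
  shows "\<not> H1 \<preceq> H2"
proof
  assume "H1 \<preceq> H2"
  then obtain t where t: "\<And>(G :: nat graph) c. complete_graph G \<Longrightarrow> card (c ` edges G) \<ge> t \<Longrightarrow>
      rainbow_free H1 G c \<Longrightarrow> rainbow_free H2 G c"
    unfolding rainbow_le_def by blast
  obtain g where g: "rainbow_copy c H2 g"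
    using copy by blast
  obtain C where C: "C \<subseteq> c ` {e. card e = 2}" "finite C" "card C = t"
    using infinite_arbitrarily_large[OF inf] by blast
  then obtain E where E: "E \<subseteq> {e. card e = 2}" "finite E" "C = c ` E"
    by (meson finite_subset_image)
  \<comment> \<open>\<open>E\<close> supplies \<open>t\<close> colors and the image of
    \<open>g\<close> carries the copy of \<open>H2\<close>; the complete graph on both together
    violates the implication.\<close>
  define V where "V = \<Union>E \<union> g ` verts H2"
  define G where "G = (V, {e. e \<subseteq> V \<and> card e = 2})"
  have "finite e" if "e \<in> E" for e
    using that E(1) by (intro card_ge_0_finite) auto
  then have V: "finite V"
    using E(2) H2 by (auto simp: V_def simple_graph_def)
  then have G: "complete_graph G"
    by (simp add: G_def complete_graph_def)
  have "E \<subseteq> edges G"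
    using E(1) by (auto simp: G_def V_def)
  moreover have "finite (edges G)"
    using V by (simp add: G_def)
  ultimately have "card (c ` edges G) \<ge> t"
    using C(3) E(3) by (metis card_mono finite_imageI image_mono)
  moreover have "rainbow_free H1 G c"
    unfolding rainbow_free_def subgraph_def using free rainbow_copy_of_iso[of _ c H1] by blast
  ultimately have "rainbow_free H2 G c"
    using t G by blast
  moreover have "\<not> rainbow_free H2 G c"
    using rainbow_copy_not_free[OF H2 G g] by (simp add: G_def V_def)
  ultimately show False
    by blast
qed

section \<open>The path and the spiders in explicit form\<close>

lemma simple_path_graph: "simple_graph (path_graph k)"
  by (auto simp: simple_graph_def path_graph_def)

text \<open>Images of finite index sets let the simplifier prove finiteness and evaluate spiders
  with concrete legs.\<close>

lemma spider_eq_Union: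
  "spider a b c =
     (\<Union>i\<in>{0,1,2}. leg i ` {..[a, b, c] ! i},
      \<Union>i\<in>{0,1,2}. (\<lambda>j. {leg i j, leg i (Suc j)}) ` {..<[a, b, c] ! i})"
proof -
  have "{0,1,2} = {..<3::nat}"
    by auto
  then show ?thesis
    unfolding spider_def by (simp only:) blast
qed

lemma simple_spider: "simple_graph (spider a b c)"
proof -
  have "finite (verts (spider a b c))"
    by (simp add: spider_eq_Union)
  moreover have "edges (spider a b c) \<subseteq> {e. e \<subseteq> verts (spider a b c) \<and> card e = 2}"
  proof
    fix e assume "e \<in> edges (spider a b c)"
    then obtain i j where e: "e = {leg i j, leg i (Suc j)}" and ij: "i < 3" "j < [a, b, c] ! i"
      by (auto simp: spider_def)
    have "leg i k \<in> verts (spider a b c)" if "k \<le> Suc j" for k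
      using that ij by (force simp: spider_def)
    moreover have "leg i j \<noteq> leg i (Suc j)"
      by (simp add: leg_def)
    ultimately show "e \<in> {e. e \<subseteq> verts (spider a b c) \<and> card e = 2}"
      by (simp add: e)
  qed
  ultimately show ?thesis
    by (simp add: simple_graph_def)
qed

lemma path_graph_6:
  "path_graph 6 = (set [0,1,2,3,4,5], set [{0,1},{1,2},{2,3},{3,4},{4,5}])"
proof -
  have "{{i, Suc i} |i. Suc i < 6} = (\<lambda>i. {i, Suc i}) ` {..<5}"
    by auto
  then show ?thesis
    by (simp add: path_graph_def numeral_eq_Suc lessThan_Suc insert_commute)
qed

lemma spider_3_1_1:
  "spider 3 1 1 = (set [(0,0),(0,1),(0,2),(0,3),(1,1),(2,1)],
     set [{(0,0),(0,1)},{(0,1),(0,2)},{(0,2),(0,3)},{(0,0),(1,1)},{(0,0),(2,1)}])"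
  by (simp add: spider_eq_Union leg_def numeral_eq_Suc lessThan_Suc atMost_Suc insert_commute)

lemma spider_2_2_1:
  "spider 2 2 1 = (set [(0,0),(0,1),(0,2),(1,1),(1,2),(2,1)],
     set [{(0,0),(0,1)},{(0,1),(0,2)},{(0,0),(1,1)},{(1,1),(1,2)},{(0,0),(2,1)}])"
  by (simp add: spider_eq_Union leg_def numeral_eq_Suc lessThan_Suc atMost_Suc insert_commute)

text \<open>For listed vertices and edges, injectivity is distinctness of the mapped list, which
  leaves finitely many disequalities.\<close>

lemma rainbow_copy_set:
  assumes "distinct vs" "distinct es"
  shows "rainbow_copy c (set vs, set es) g \<longleftrightarrow> distinct (map g vs) \<and> distinct (map (\<lambda>e. c (g ` e)) es)"
  using assms by (simp add: rainbow_copy_def distinct_map)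

lemma rainbow_copy_path_graph_6:
  "rainbow_copy c (path_graph 6) g \<longleftrightarrow> distinct (map g [0,1,2,3,4,5]) \<and>
     distinct [c {g 0, g 1}, c {g 1, g 2}, c {g 2, g 3}, c {g 3, g 4}, c {g 4, g 5}]"
  unfolding path_graph_6 by (subst rainbow_copy_set) (simp_all add: doubleton_eq_iff)

lemma rainbow_copy_spider_3_1_1:
  "rainbow_copy c (spider 3 1 1) g \<longleftrightarrow> distinct (map g [(0,0),(0,1),(0,2),(0,3),(1,1),(2,1)]) \<and>
     distinct [c {g (0,0), g (0,1)}, c {g (0,1), g (0,2)}, c {g (0,2), g (0,3)},
       c {g (0,0), g (1,1)}, c {g (0,0), g (2,1)}]"
  unfolding spider_3_1_1 by (subst rainbow_copy_set) (simp_all add: doubleton_eq_iff)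

lemma rainbow_copy_spider_2_2_1:
  "rainbow_copy c (spider 2 2 1) g \<longleftrightarrow> distinct (map g [(0,0),(0,1),(0,2),(1,1),(1,2),(2,1)]) \<and>
     distinct [c {g (0,0), g (0,1)}, c {g (0,1), g (0,2)}, c {g (0,0), g (1,1)},
       c {g (1,1), g (1,2)}, c {g (0,0), g (2,1)}]"
  unfolding spider_2_2_1 by (subst rainbow_copy_set) (simp_all add: doubleton_eq_iff)

section \<open>The three colorings and their infinitely many colors\<close>

definition star_triangle :: "nat coloring" where
  "star_triangle e = (if e \<subseteq> {0,1,2} then 1 else if 0 \<in> e then Max e else 0)"

text \<open>The matching edges are the pairs \<open>{2 * k, 2 * k + 1}\<close>.\<close>

definition matching_K4 :: "nat coloring" where
  "matching_K4 e =
    (if \<exists>i. (\<lambda>x. x div 2) ` e = {i} then Max e div 2 + 2 else if e \<subseteq> {..<4} then 1 else 0)"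

text \<open>\<open>Min e\<close> is 1 on the two triangle edges at 1 and 2 on the third edge;
  \<open>Max e\<close> is the outer end of a star edge, hence at least 4.\<close>

definition star_plus_triangle :: "nat coloring" where
  "star_plus_triangle e =
    (if e \<subseteq> {1,2,3} then Min e else if 0 \<in> e \<and> e \<inter> {1,2,3} = {} then Max e else 0)"

lemma star_triangle_pair:
  "star_triangle {x, y} = (if x \<le> 2 \<and> y \<le> 2 then 1 else if x = 0 then y else if y = 0 then x else 0)"
  by (auto simp: star_triangle_def)

lemma star_plus_triangle_pair:
  "star_plus_triangle {x, y} =
    (if x \<in> {1,2,3} \<and> y \<in> {1,2,3} then min x y else if x = 0 \<and> y \<notin> {1,2,3} then y
     else if y = 0 \<and> x \<notin> {1,2,3} then x else 0)"
  by (auto simp: star_plus_triangle_def)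

text \<open>The offset 2 keeps the matching colors apart from the background 0 and the further color
  1.\<close>

lemma matching_K4_pair:
  "matching_K4 {x, y} = (if x div 2 = y div 2 then x div 2 + 2 else if x < 4 \<and> y < 4 then 1 else 0)"
  by (simp add: matching_K4_def max_def)

lemma infinite_colors:
  fixes c :: "nat coloring"
  assumes "\<And>k. k \<ge> m \<Longrightarrow> \<exists>x y. x \<noteq> y \<and> c {x, y} = k"
  shows "infinite (c ` {e. card e = 2})"
proof -
  have "{m..} \<subseteq> c ` {e. card e = 2}"
  proof
    fix k assume "k \<in> {m..}"
    then have "\<exists>x y. x \<noteq> y \<and> c {x, y} = k"
      using assms by simp
    then obtain x y where "x \<noteq> y" "c {x, y} = k"
      by blast
    then show "k \<in> c ` {e. card e = 2}"
      by (intro image_eqI[of _ _ "{x, y}"]) auto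
  qed
  then show ?thesis
    using infinite_Ici infinite_super by blast
qed

lemma infinite_star_triangle: "infinite (star_triangle ` {e. card e = 2})"
proof (rule infinite_colors)
  fix k :: nat assume "k \<ge> 3"
  then have "0 \<noteq> k \<and> star_triangle {0, k} = k"
    by (simp add: star_triangle_pair)
  then show "\<exists>x y. x \<noteq> y \<and> star_triangle {x, y} = k"
    by blast
qed

lemma infinite_star_plus_triangle: "infinite (star_plus_triangle ` {e. card e = 2})"
proof (rule infinite_colors)
  fix k :: nat assume "k \<ge> 4"
  then have "0 \<noteq> k \<and> star_plus_triangle {0, k} = k"
    by (simp add: star_plus_triangle_pair)
  then show "\<exists>x y. x \<noteq> y \<and> star_plus_triangle {x, y} = k"
    by blast
qed

lemma infinite_matching_K4: "infinite (matching_K4 ` {e. card e = 2})"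
proof (rule infinite_colors)
  fix k :: nat assume "k \<ge> 2"
  then have "2 * (k - 2) \<noteq> 2 * (k - 2) + 1 \<and> matching_K4 {2 * (k - 2), 2 * (k - 2) + 1} = k"
    by (simp add: matching_K4_pair)
  then show "\<exists>x y. x \<noteq> y \<and> matching_K4 {x, y} = k"
    by blast
qed

section \<open>Rainbow copies that exist\<close>

lemma star_triangle_spider_3_1_1: "\<exists>g. rainbow_copy star_triangle (spider 3 1 1) g"
  unfolding rainbow_copy_spider_3_1_1
  \<comment> \<open>The long leg 0, 3, 1, 2 has colors 3, 0, 1; the short legs have 4 and 5.\<close>
  by (rule exI[of _ "\<lambda>(i, j). [[0,3,1,2],[0,4],[0,5]] ! i ! j"]) (simp add: star_triangle_pair)

lemma matching_K4_path_graph_6: "\<exists>g. rainbow_copy matching_K4 (path_graph 6) g"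
  unfolding rainbow_copy_path_graph_6
  \<comment> \<open>The colors along this path are 4, 0, 2, 1, 3.\<close>
  by (rule exI[of _ "(!) [5,4,0,1,2,3]"]) (simp add: matching_K4_pair)

lemma star_plus_triangle_path_graph_6: "\<exists>g. rainbow_copy star_plus_triangle (path_graph 6) g"
  unfolding rainbow_copy_path_graph_6
  \<comment> \<open>The colors along this path are 4, 5, 0, 1, 2.\<close>
  by (rule exI[of _ "(!) [4,0,5,1,2,3]"]) (simp add: star_plus_triangle_pair)

section \<open>Rainbow copies that are excluded\<close>

text \<open>Edges avoiding 0 have only the colors 0 and 1, too few for three distinct ones.\<close>

lemma star_triangle_meets_center:
  assumes "distinct [star_triangle {t, u}, star_triangle {v, w}, star_triangle {x, y}]"
  shows "0 \<in> {t, u, v, w, x, y}"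
proof (rule ccontr)
  assume "0 \<notin> {t, u, v, w, x, y}"
  then have "star_triangle {t, u} \<le> 1" "star_triangle {v, w} \<le> 1" "star_triangle {x, y} \<le> 1"
    by (simp_all add: star_triangle_pair)
  then show False
    using assms by simp
qed

lemma star_triangle_no_path_graph_6: "\<not> rainbow_copy star_triangle (path_graph 6) g"
proof
  define u v w x y z where "u = g 0" "v = g 1" "w = g 2" "x = g 3" "y = g 4" "z = g 5"
  note defs = this
  assume "rainbow_copy star_triangle (path_graph 6) g"
  then have dist: "distinct [u, v, w, x, y, z]"
    and rb: "distinct [star_triangle {u, v}, star_triangle {v, w}, star_triangle {w, x},
        star_triangle {x, y}, star_triangle {y, z}]"
    unfolding rainbow_copy_path_graph_6 by (simp_all add: defs)
  \<comment> \<open>The first two triples of edges leave only \<open>w\<close> and \<open>x\<close>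
    for 0; the third misses \<open>w\<close>, the fourth \<open>x\<close>.\<close>
  have "0 \<in> {u, v, v, w, w, x}" "0 \<in> {w, x, x, y, y, z}"
    "0 \<in> {u, v, x, y, y, z}" "0 \<in> {u, v, v, w, y, z}"
    by (rule star_triangle_meets_center, use rb in simp)+
  then show False
    using dist by auto
qed

lemma star_triangle_no_spider_2_2_1: "\<not> rainbow_copy star_triangle (spider 2 2 1) g"
proof
  define b p q x y z where "b = g (0,0)" "p = g (0,1)" "q = g (0,2)" "x = g (1,1)" "y = g (1,2)"
    "z = g (2,1)"
  note defs = this
  assume "rainbow_copy star_triangle (spider 2 2 1) g"
  then have dist: "distinct [b, p, q, x, y, z]"
    and rb: "distinct [star_triangle {b, p}, star_triangle {p, q}, star_triangle {b, x},
        star_triangle {x, y}, star_triangle {b, z}]"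
    unfolding rainbow_copy_spider_2_2_1 by (simp_all add: defs)
  \<comment> \<open>The first two triples share \<open>b\<close>, \<open>p\<close>,
    \<open>x\<close>; the third misses \<open>p\<close> and the fourth \<open>x\<close>, so only
    \<open>b\<close> remains.\<close>
  have "0 \<in> {b, p, p, q, b, x}" "0 \<in> {b, p, b, x, b, z}"
    "0 \<in> {b, x, x, y, b, z}" "0 \<in> {b, p, p, q, b, z}"
    by (rule star_triangle_meets_center, use rb in simp)+
  then have "b = 0"
    using dist by auto
  then have "star_triangle {b, u} = (if u \<le> 2 then 1 else u)" for u
    by (simp add: star_triangle_pair)
  moreover have "star_triangle {p, q} = (if p \<le> 2 \<and> q \<le> 2 then 1 else 0)"
    "star_triangle {x, y} = (if x \<le> 2 \<and> y \<le> 2 then 1 else 0)"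
    using dist \<open>b = 0\<close> by (auto simp: star_triangle_pair)
  ultimately show False
    using rb by (cases "p \<le> 2"; cases "x \<le> 2"; cases "q \<le> 2"; cases "y \<le> 2") simp_all
qed

lemma matching_K4_adjacent:
  assumes "distinct [x, y, z]"
  shows "matching_K4 {x, y} \<le> 1 \<or> matching_K4 {x, z} \<le> 1"
proof -
  have "u mod 2 \<noteq> v mod 2" if "u \<noteq> v" "u div 2 = v div 2" for u v :: nat
    using that by (metis div_mult_mod_eq)
  \<comment> \<open>Three distinct numbers with one common quotient would need three different
    parities.\<close>
  then have "x div 2 \<noteq> y div 2 \<or> x div 2 \<noteq> z div 2"
    using assms by (metis distinct_length_2_or_more not_mod_2_eq_0_eq_1)
  then show ?thesis
    by (auto simp: matching_K4_pair)
qed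

lemma matching_K4_no_spider_3_1_1: "\<not> rainbow_copy matching_K4 (spider 3 1 1) g"
proof
  define b p q r x y where "b = g (0,0)" "p = g (0,1)" "q = g (0,2)" "r = g (0,3)" "x = g (1,1)"
    "y = g (2,1)"
  note defs = this
  assume "rainbow_copy matching_K4 (spider 3 1 1) g"
  then have dist: "distinct [b, p, q, r, x, y]"
    and rb: "distinct [matching_K4 {b, p}, matching_K4 {p, q}, matching_K4 {q, r},
        matching_K4 {b, x}, matching_K4 {b, y}]"
    unfolding rainbow_copy_spider_3_1_1 by (simp_all add: defs)
  have "matching_K4 {b, p} \<le> 1 \<or> matching_K4 {b, x} \<le> 1"
    "matching_K4 {b, p} \<le> 1 \<or> matching_K4 {b, y} \<le> 1"
    "matching_K4 {b, x} \<le> 1 \<or> matching_K4 {b, y} \<le> 1"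
    "matching_K4 {q, p} \<le> 1 \<or> matching_K4 {q, r} \<le> 1"
    by (rule matching_K4_adjacent, (use dist in auto)[1])+
  moreover have three: "\<not> (k \<le> 1 \<and> l \<le> 1 \<and> m \<le> 1)" if "distinct [k, l, m]" for k l m :: nat
    using that by auto
  \<comment> \<open>By adjacency some two edges at \<open>b\<close> and one at \<open>q\<close> lie
    outside the matching, but their three distinct colors do not fit into 0 and 1.\<close>
  have "\<not> (matching_K4 {b, u} \<le> 1 \<and> matching_K4 {b, v} \<le> 1 \<and> matching_K4 {q, w} \<le> 1)"
    if "(u, v) \<in> {(p, x), (p, y), (x, y)}" "w \<in> {p, r}" for u v w
    by (rule three) (use that rb in \<open>auto simp: insert_commute[of q p]\<close>)
  ultimately show False
    by blast
qed

text \<open>The edges of nonzero color form a triangle and a disjoint star, neither of which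
  contains a path on four vertices.\<close>

lemma star_plus_triangle_path_4:
  assumes "distinct [w, x, y, z]"
  shows "0 \<in> {star_plus_triangle {w, x}, star_plus_triangle {x, y}, star_plus_triangle {y, z}}"
proof (rule ccontr)
  define T where "T = {1,2,3::nat}"
  have good: "(u \<in> T \<longleftrightarrow> v \<in> T) \<and> (u \<in> T \<or> u = 0 \<or> v = 0)"
    if "star_plus_triangle {u, v} \<noteq> 0" for u v
    using that unfolding star_plus_triangle_pair T_def by (simp split: if_splits)
  assume "\<not> ?thesis"
  then have g: "star_plus_triangle {w, x} \<noteq> 0" "star_plus_triangle {x, y} \<noteq> 0"
    "star_plus_triangle {y, z} \<noteq> 0"
    by auto
  note good = good[OF g(1)] good[OF g(2)] good[OF g(3)]
  show False
  proof (cases "x \<in> T")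
    case True
    then have "{w, x, y, z} \<subseteq> T"
      using good by simp
    then have "card {w, x, y, z} \<le> card T"
      by (intro card_mono) (auto simp: T_def)
    then show ?thesis
      using assms by (simp add: T_def)
  next
    case False
    \<comment> \<open>Inside the star, the two disjoint end edges of the path would both contain
      0.\<close>
    then have "w = 0 \<or> x = 0" "y = 0 \<or> z = 0"
      using good by blast+
    then show ?thesis
      using assms by auto
  qed
qed

lemma star_plus_triangle_no_spider_2_2_1: "\<not> rainbow_copy star_plus_triangle (spider 2 2 1) g"
proof
  define b p q x y z where "b = g (0,0)" "p = g (0,1)" "q = g (0,2)" "x = g (1,1)" "y = g (1,2)"
    "z = g (2,1)"
  note defs = this
  assume "rainbow_copy star_plus_triangle (spider 2 2 1) g"
  then have dist: "distinct [b, p, q, x, y, z]"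
    and rb: "distinct [star_plus_triangle {b, p}, star_plus_triangle {p, q}, star_plus_triangle {b, x},
        star_plus_triangle {x, y}, star_plus_triangle {b, z}]"
    unfolding rainbow_copy_spider_2_2_1 by (simp_all add: defs)
  \<comment> \<open>The two paths differ only in their last edge. Color 0 occurs at most once, so it
    cannot be on both last edges and lies on the leg through \<open>p\<close> and \<open>q\<close>;
    likewise for \<open>x\<close> and \<open>y\<close> below.\<close>
  have "0 \<in> {star_plus_triangle {q, p}, star_plus_triangle {p, b}, star_plus_triangle {b, x}}"
    "0 \<in> {star_plus_triangle {q, p}, star_plus_triangle {p, b}, star_plus_triangle {b, z}}"
    by (rule star_plus_triangle_path_4, (use dist in auto)[1])+
  then have "star_plus_triangle {p, q} = 0 \<or> star_plus_triangle {b, p} = 0"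
    unfolding insert_commute[of q p] insert_commute[of p b] using rb by simp metis
  moreover have "0 \<in> {star_plus_triangle {y, x}, star_plus_triangle {x, b}, star_plus_triangle {b, p}}"
    "0 \<in> {star_plus_triangle {y, x}, star_plus_triangle {x, b}, star_plus_triangle {b, z}}"
    by (rule star_plus_triangle_path_4, (use dist in auto)[1])+
  then have "star_plus_triangle {x, y} = 0 \<or> star_plus_triangle {b, x} = 0"
    unfolding insert_commute[of y x] insert_commute[of x b] using rb by simp metis
  ultimately show False
    using rb by simp metis
qed

theorem theorem15:
  "\<not> spider 2 2 1 \<preceq> spider 3 1 1 \<and>
   \<not> path_graph 6 \<preceq> spider 3 1 1 \<and>
   \<not> spider 3 1 1 \<preceq> path_graph 6 \<and>
   \<not> spider 2 2 1 \<preceq> path_graph 6"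
proof (intro conjI)
  show "\<not> spider 2 2 1 \<preceq> spider 3 1 1"
    using not_rainbow_leI[OF infinite_star_triangle] star_triangle_no_spider_2_2_1 simple_spider
      star_triangle_spider_3_1_1 by blast
  show "\<not> path_graph 6 \<preceq> spider 3 1 1"
    using not_rainbow_leI[OF infinite_star_triangle] star_triangle_no_path_graph_6 simple_spider
      star_triangle_spider_3_1_1 by blast
  show "\<not> spider 3 1 1 \<preceq> path_graph 6"
    using not_rainbow_leI[OF infinite_matching_K4] matching_K4_no_spider_3_1_1 simple_path_graph
      matching_K4_path_graph_6 by blast
  show "\<not> spider 2 2 1 \<preceq> path_graph 6"
    using not_rainbow_leI[OF infinite_star_plus_triangle] star_plus_triangle_no_spider_2_2_1
      simple_path_graph star_plus_triangle_path_graph_6 by blast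
qed

end
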